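(* For every positive integer $k$ there exists a positive real number $h_k$ such that w.h.p. $\tau(\mathcal D_k,n)=(h_k+o(1))n$.
   Context: Semi-random multigraph process (online version): fix $n$ and start with the empty multigraph on $[n]$. In each round $t$, a vertex $v_t$ is chosen uniformly at random from $[n]$, independently of all previous rounds; Builder then chooses $u_t\in[n]$ (possibly $u_t=v_t$), which may depend only on $v_1,\dots,v_t$, his earlier choices and his own randomness, and adds the edge $u_tv_t$ (loops and multiple edges allowed). For a monotone increasing property $\mathcal P$ and $0\le p\le1$, $\tau_p(\mathcal P,n)$ is the least $m$ such that some strategy yields, after $m$ rounds, a multigraph in $\mathcal P$ with probability at least $p$. "W.h.p. $\tau(\mathcal P,n)=(c+o(1))n$" means that for every fixed $\delta>0$, $\tau_{1-o(1)}(\mathcal P,n)\le(c+\delta)n$ (some strategy achieves $\mathcal P$ within $(c+\delta)n$ rounds with probability $1-o(1)$) and $\tau_{o(1)}(\mathcal P,n)\ge (c-\delta)n$ (for every strategy, w.h.p. $\mathcal P$ fails after $(c-\delta)n$ rounds). $\mathcal D_k$ is the property that every vertex has at least $k$ distinct neighbours other than itself (loops and multiplicities ignored). *)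

theory Defs
  imports "HOL-Probability.Probability" "HOL-Library.Uprod"
begin

text \<open>
  A multigraph on the vertex set \<open>{1..n}\<close> is the multiset of its edges; an edge is an unordered
  pair, and \<open>Upair v v\<close> is a loop.
\<close>

type_synonym multigraph = "nat uprod multiset"

text \<open>A graph property may refer to the number \<open>n\<close> of vertices, its first argument.\<close>

type_synonym property = "nat \<Rightarrow> multigraph \<Rightarrow> bool"

definition neighbours :: "multigraph \<Rightarrow> nat \<Rightarrow> nat set" where
  "neighbours G v = {w. w \<noteq> v \<and> Upair v w \<in># G}"

definition min_neighbours :: "nat \<Rightarrow> property" where
  "min_neighbours k n G \<longleftrightarrow> (\<forall>v\<in>{1..n}. card (neighbours G v) \<ge> k)"

text \<open>
  The history of a run is the list of pairs \<open>(u\<^sub>t, v\<^sub>t)\<close> played so far, in chronological order.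
  Builder maps the history and the vertex \<open>v\<^sub>t\<close> just offered to a probability distribution, from
  which \<open>u\<^sub>t\<close> is drawn.  There is no separate seed for Builder's private randomness:
  whatever randomness he uses, the run has the law given by the conditional distributions
  of \<open>u\<^sub>t\<close> given the history and \<open>v\<^sub>t\<close>, so these kernels cover all randomised strategies.
\<close>

type_synonym history = "(nat \<times> nat) list"
type_synonym strategy = "history \<Rightarrow> nat \<Rightarrow> nat pmf"

definition strategy_on :: "nat \<Rightarrow> strategy \<Rightarrow> bool" where
  "strategy_on n \<sigma> \<longleftrightarrow> (\<forall>h v. set_pmf (\<sigma> h v) \<subseteq> {1..n})"

primrec semi_random :: "nat \<Rightarrow> strategy \<Rightarrow> nat \<Rightarrow> history pmf" where
  "semi_random n \<sigma> 0 = return_pmf []"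
| "semi_random n \<sigma> (Suc t) =
     bind_pmf (semi_random n \<sigma> t) (\<lambda>h.
     bind_pmf (pmf_of_set {1..n}) (\<lambda>v.
     bind_pmf (\<sigma> h v) (\<lambda>u.
     return_pmf (h @ [(u, v)]))))"

definition graph_of :: "history \<Rightarrow> multigraph" where
  "graph_of h = mset (map (\<lambda>(u, v). Upair u v) h)"

text \<open>
  The value is \<open>\<infinity>\<close> if no number of rounds suffices, as for \<open>min_neighbours k\<close> with
  \<open>n \<le> k\<close> and \<open>p > 0\<close>.
\<close>

definition tau :: "real \<Rightarrow> property \<Rightarrow> nat \<Rightarrow> enat" where
  "tau p P n = Inf {enat m |m. \<exists>\<sigma>. strategy_on n \<sigma> \<and>
     measure_pmf.prob (semi_random n \<sigma> m) {h. P n (graph_of h)} \<ge> p}"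

text \<open>
  ``W.h.p. \<open>\<tau>(P, n) = (c + o(1)) n\<close>''.  Each \<open>o(1)\<close> in a subscript of \<open>\<tau>\<close> is some null sequence
  \<open>\<epsilon>\<close>, which may depend on \<open>\<delta>\<close>.  In the lower bound, a single \<open>\<epsilon>\<close> bounding the success
  probability of all strategies is the same as convergence to \<open>0\<close> along every sequence of
  strategies.
\<close>

definition whp_tau_asymp :: "property \<Rightarrow> real \<Rightarrow> bool" where
  "whp_tau_asymp P c \<longleftrightarrow> (\<forall>\<delta>>0.
     (\<exists>\<epsilon>::nat \<Rightarrow> real. (\<forall>n. 0 \<le> \<epsilon> n \<and> \<epsilon> n \<le> 1) \<and> \<epsilon> \<longlonglongrightarrow> 0 \<and>
        (\<forall>\<^sub>F n in sequentially.
           ereal_of_enat (tau (1 - \<epsilon> n) P n) \<le> ereal ((c + \<delta>) * real n))) \<and>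
     (\<exists>\<epsilon>::nat \<Rightarrow> real. (\<forall>n. 0 \<le> \<epsilon> n \<and> \<epsilon> n \<le> 1) \<and> \<epsilon> \<longlonglongrightarrow> 0 \<and>
        (\<forall>\<^sub>F n in sequentially.
           ereal_of_enat (tau (\<epsilon> n) P n) \<ge> ereal ((c - \<delta>) * real n))))"

lemma finite_neighbours: "finite (neighbours G v)"
proof (rule finite_subset)
  show "neighbours G v \<subseteq> (\<Union>e\<in>set_mset G. set_uprod e)"
    by (force simp: neighbours_def)
  have "finite (set_uprod e)" for e :: "nat uprod"
    by (cases e) simp
  then show "finite (\<Union>e\<in>set_mset G. set_uprod e)" by simp
qed

lemma min_neighbours_mono:
  assumes "min_neighbours k n G" "G \<subseteq># H"
  shows "min_neighbours k n H"
proof -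
  have "neighbours G v \<subseteq> neighbours H v" for v
    using assms(2) by (auto simp: neighbours_def dest: mset_subset_eqD)
  then have "card (neighbours G v) \<le> card (neighbours H v)" for v
    by (simp add: card_mono finite_neighbours)
  then show ?thesis
    using assms(1) unfolding min_neighbours_def by (meson order_trans)
qed

end

theory Submission imports Defs "HOL-Real_Asymp.Real_Asymp" begin

text \<open>
  The deficiency of a graph is the total number of neighbours its vertices lack.  Let \<open>e\<^sub>n(m)\<close> be
  the least expected deficiency Builder can reach in \<open>m\<close> rounds on \<open>n\<close> vertices.  One edge changes
  the deficiency by at most 2, so the optimal expected final deficiency is a submartingale with
  bounded increments under every strategy, and a martingale under an optimal one; hence final
  deficiencies are concentrated on the scale \<open>\<surd>m\<close>.  If \<open>e\<^sub>n(m)\<close> is at least linear in \<open>n\<close>, every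
  strategy fails w.h.p.; if it is \<open>o(n)\<close>, then \<open>o(n)\<close> extra rounds repair the remaining vertices.
  Playing separately in blocks of size \<open>q\<close> bounds \<open>e\<^sub>n(rn/q) / n\<close> by \<open>(e\<^sub>q(r) + O(\<surd>r)) / q\<close>
  up to \<open>o(1)\<close>, so both cases are separated by a single rate \<open>h\<close>.
\<close>

section \<open>The optimal expected deficiency\<close>

text \<open>Truncated subtraction keeps surplus neighbours of one vertex from offsetting a lack at
  another. Neighbours outside \<open>S\<close> count too.\<close>

definition deficiency :: "nat \<Rightarrow> nat set \<Rightarrow> multigraph \<Rightarrow> real" where
  "deficiency k S G = (\<Sum>v\<in>S. real (k - card (neighbours G v)))"

text \<open>Backward induction for the game on \<open>S\<close>: the minimum stands inside the
  average because Builder sees \<open>v\<close> before he picks \<open>u\<close>.\<close>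

primrec opt_deficiency :: "nat \<Rightarrow> nat set \<Rightarrow> nat \<Rightarrow> multigraph \<Rightarrow> real" where
  "opt_deficiency k S 0 G = deficiency k S G"
| "opt_deficiency k S (Suc r) G =
     (\<Sum>v\<in>S. Min ((\<lambda>u. opt_deficiency k S r (add_mset (Upair u v) G)) ` S)) / card S"

lemma neighbours_add_edge:
  "neighbours (add_mset (Upair u v) G) x =
     neighbours G x \<union> (if x = u \<and> u \<noteq> v then {v} else {}) \<union> (if x = v \<and> u \<noteq> v then {u} else {})"
  by (auto simp: neighbours_def)

lemma neighbours_empty [simp]: "neighbours {#} x = {}"
  by (simp add: neighbours_def)

lemma deficiency_nonneg: "0 \<le> deficiency k S G"
  by (simp add: deficiency_def sum_nonneg)

lemma deficiency_le: "deficiency k S G \<le> k * card S"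
proof -
  have "deficiency k S G \<le> (\<Sum>v\<in>S. real k)"
    unfolding deficiency_def by (intro sum_mono) auto
  then show ?thesis by (simp add: mult.commute)
qed

lemma deficiency_empty: "deficiency k S {#} = k * card S"
  by (simp add: deficiency_def)

lemma deficiency_add_edge_le: "deficiency k S (add_mset (Upair u v) G) \<le> deficiency k S G"
  unfolding deficiency_def
  by (intro sum_mono of_nat_mono diff_le_mono2 card_mono finite_neighbours)
    (auto simp: neighbours_add_edge)

lemma deficiency_le_add_edge:
  assumes "finite S"
  shows "deficiency k S G \<le> deficiency k S (add_mset (Upair u v) G) + 2"
proof -
  let ?G = "add_mset (Upair u v) G"
  have *: "real (k - card (neighbours G x)) \<le>
      real (k - card (neighbours ?G x)) + (if x = u then 1 else 0) + (if x = v then 1 else 0)" for x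
    using card_insert_le_m1 finite_neighbours[of G x]
    by (auto simp: neighbours_add_edge card_insert_if)
  have "deficiency k S G \<le> (\<Sum>x\<in>S. real (k - card (neighbours ?G x)) +
      (if x = u then 1 else 0) + (if x = v then 1 else 0))"
    unfolding deficiency_def by (intro sum_mono *)
  also have "\<dots> \<le> deficiency k S ?G + 2"
    using assms by (simp add: sum.distrib deficiency_def)
  finally show ?thesis .
qed

lemma min_neighbours_iff_deficiency:
  "min_neighbours k n G \<longleftrightarrow> deficiency k {1..n} G = 0"
  unfolding deficiency_def min_neighbours_def
  by (subst sum_nonneg_eq_0_iff) auto

section \<open>Effect of one edge or one round on the optimal value\<close>

lemma Min_image_le_Min_image_add:
  fixes f g :: "'a \<Rightarrow> real"
  assumes "finite S" "S \<noteq> {}" "\<And>u. u \<in> S \<Longrightarrow> f u \<le> g u + c"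
  shows "Min (f ` S) \<le> Min (g ` S) + c"
proof -
  have "Min (g ` S) \<in> g ` S" using assms by (intro Min_in) auto
  then obtain u where u: "u \<in> S" "Min (g ` S) = g u" by auto
  have "Min (f ` S) \<le> f u" using u assms by (intro Min_le) auto
  then show ?thesis using u assms(3)[of u] by simp
qed

lemma sum_divide_card_le:
  fixes f :: "'a \<Rightarrow> real"
  assumes "finite S" "S \<noteq> {}" "\<And>v. v \<in> S \<Longrightarrow> f v \<le> c"
  shows "(\<Sum>v\<in>S. f v) / card S \<le> c"
proof -
  have "(\<Sum>v\<in>S. f v) \<le> card S * c"
    using assms by (intro sum_bounded_above)
  moreover have "card S > 0" using assms by (simp add: card_gt_0_iff)
  ultimately show ?thesis by (simp add: divide_le_eq mult.commute)
qed

lemma le_sum_divide_card: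
  fixes f :: "'a \<Rightarrow> real"
  assumes "finite S" "S \<noteq> {}" "\<And>v. v \<in> S \<Longrightarrow> c \<le> f v"
  shows "c \<le> (\<Sum>v\<in>S. f v) / card S"
  using sum_divide_card_le[of S "\<lambda>v. - f v" "- c"] assms by (simp add: sum_negf)

text \<open>The added edge commutes with all edges played later, so it can be carried to the end of
  the game, where the bounds hold for \<open>deficiency\<close>; minimum and average preserve
  them.\<close>

lemma opt_deficiency_lipschitz:
  assumes "finite S" "S \<noteq> {}"
  shows "opt_deficiency k S r (add_mset (Upair x y) G) \<le> opt_deficiency k S r G"
    and "opt_deficiency k S r G \<le> opt_deficiency k S r (add_mset (Upair x y) G) + 2"
proof (induction r arbitrary: G)
  case 0
  {
    case 1
    show ?case by (simp add: deficiency_add_edge_le)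
  next
    case 2
    show ?case using assms by (simp add: deficiency_le_add_edge)
  }
next
  case (Suc r)
  let ?M = "\<lambda>G v. Min ((\<lambda>u. opt_deficiency k S r (add_mset (Upair u v) G)) ` S)"
  have c: "add_mset (Upair u v) (add_mset (Upair x y) G) =
      add_mset (Upair x y) (add_mset (Upair u v) G)" for u v G
    by (rule add_mset_commute)
  {
    case 1
    have "?M (add_mset (Upair x y) G) v \<le> ?M G v + 0" for v
      using assms by (intro Min_image_le_Min_image_add) (simp_all add: c Suc.IH(1))
    then show ?case by (auto intro!: divide_right_mono sum_mono)
  next
    case 2
    have *: "?M G v \<le> ?M (add_mset (Upair x y) G) v + 2" for v
      using assms by (intro Min_image_le_Min_image_add) (simp_all add: c Suc.IH(2))
    have "(\<Sum>v\<in>S. ?M G v - ?M (add_mset (Upair x y) G) v) / card S \<le> 2"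
      using assms * by (intro sum_divide_card_le) (auto simp: algebra_simps)
    then show ?case by (simp add: sum_subtractf diff_divide_distrib)
  }
qed

text \<open>The additional round is played first: it adds an edge and leaves \<open>r\<close>
  rounds, so the bounds for an added edge apply to each \<open>v\<close> and survive
  averaging.\<close>

lemma opt_deficiency_Suc:
  assumes "finite S" "S \<noteq> {}"
  shows "opt_deficiency k S (Suc r) G \<le> opt_deficiency k S r G"
    and "opt_deficiency k S r G \<le> opt_deficiency k S (Suc r) G + 2"
proof -
  let ?f = "\<lambda>v u. opt_deficiency k S r (add_mset (Upair u v) G)"
  have "Min (?f v ` S) \<in> ?f v ` S" for v using assms by (intro Min_in) auto
  then have *: "\<exists>u. Min (?f v ` S) = ?f v u" for v by auto
  have 1: "Min (?f v ` S) \<le> opt_deficiency k S r G" for v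
    using *[of v] opt_deficiency_lipschitz(1)[OF assms] by metis
  have 2: "opt_deficiency k S r G - 2 \<le> Min (?f v ` S)" for v
    using *[of v] opt_deficiency_lipschitz(2)[OF assms] by (metis diff_le_eq)
  show "opt_deficiency k S (Suc r) G \<le> opt_deficiency k S r G"
    using sum_divide_card_le[OF assms 1] by simp
  show "opt_deficiency k S r G \<le> opt_deficiency k S (Suc r) G + 2"
    using le_sum_divide_card[OF assms, of "opt_deficiency k S r G - 2" "\<lambda>v. Min (?f v ` S)", OF 2]
    by simp
qed

lemma opt_deficiency_nonneg:
  assumes "finite S" "S \<noteq> {}"
  shows "0 \<le> opt_deficiency k S r G"
proof (induction r arbitrary: G)
  case 0
  show ?case by (simp add: deficiency_nonneg)
next
  case (Suc r)
  then have "0 \<le> Min ((\<lambda>u. opt_deficiency k S r (add_mset (Upair u v) G)) ` S)" for v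
    using assms by (subst Min_ge_iff) auto
  then show ?case by (auto intro!: divide_nonneg_nonneg sum_nonneg)
qed

lemma opt_deficiency_antimono:
  assumes "finite S" "S \<noteq> {}" "r \<le> s"
  shows "opt_deficiency k S s G \<le> opt_deficiency k S r G"
  using assms(3)
proof (induction s rule: dec_induct)
  case (step s)
  then show ?case using opt_deficiency_Suc(1)[OF assms(1,2), of k s G] by linarith
qed simp

lemma deficiency_le_opt_deficiency:
  assumes "finite S" "S \<noteq> {}"
  shows "deficiency k S G \<le> opt_deficiency k S r G + 2 * r"
proof (induction r)
  case (Suc r)
  then show ?case using opt_deficiency_Suc(2)[OF assms, of k r G] by simp
qed simp

text \<open>Only neighbour sets enter the value, so an injection that transports them transports the
  value. Vertices of \<open>S\<close> may already have neighbours in \<open>T\<close> outside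
  \<open>S\<close>, which \<open>f\<close> must not merge.\<close>

lemma opt_deficiency_iso:
  assumes "finite S" "S \<subseteq> T" "inj_on f T"
    and "\<And>v. v \<in> S \<Longrightarrow> neighbours G v \<subseteq> T"
    and "\<And>v. v \<in> S \<Longrightarrow> neighbours H (f v) = f ` neighbours G v"
  shows "opt_deficiency k (f ` S) r H = opt_deficiency k S r G"
  using assms(4,5)
proof (induction r arbitrary: G H)
  case 0
  have inj: "inj_on f S" using assms inj_on_subset by blast
  have "card (neighbours H (f v)) = card (neighbours G v)" if "v \<in> S" for v
    using 0 that assms(3) by (simp add: card_image inj_on_subset)
  then show ?case by (simp add: deficiency_def sum.reindex[OF inj])
next
  case (Suc r)
  have inj: "inj_on f S" using assms inj_on_subset by blast
  have "opt_deficiency k (f ` S) r (add_mset (Upair (f u) (f v)) H) =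
      opt_deficiency k S r (add_mset (Upair u v) G)" if "u \<in> S" "v \<in> S" for u v
  proof (rule Suc.IH)
    fix x assume x: "x \<in> S"
    show "neighbours (add_mset (Upair u v) G) x \<subseteq> T"
      using Suc.prems(1)[OF x] that assms(2) by (auto simp: neighbours_add_edge)
    have eqs: "f x = f u \<longleftrightarrow> x = u" "f x = f v \<longleftrightarrow> x = v" "f u = f v \<longleftrightarrow> u = v"
      using inj x that by (simp_all add: inj_on_eq_iff)
    show "neighbours (add_mset (Upair (f u) (f v)) H) (f x) =
        f ` neighbours (add_mset (Upair u v) G) x"
      unfolding neighbours_add_edge Suc.prems(2)[OF x] image_Un eqs
      by (simp only: if_distrib[of "image f"] image_insert image_empty)
  qed
  then have "Min ((\<lambda>u. opt_deficiency k (f ` S) r (add_mset (Upair u (f v)) H)) ` f ` S) =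
      Min ((\<lambda>u. opt_deficiency k S r (add_mset (Upair u v) G)) ` S)" if "v \<in> S" for v
    unfolding image_image using that by (intro arg_cong[where f = Min] image_cong) auto
  then show ?case by (simp add: sum.reindex[OF inj] card_image[OF inj])
qed

lemma opt_deficiency_cong:
  assumes "finite S" "\<And>v. v \<in> S \<Longrightarrow> neighbours H v = neighbours G v"
  shows "opt_deficiency k S r H = opt_deficiency k S r G"
  using opt_deficiency_iso[of S UNIV id G H k r] assms by simp

lemma opt_deficiency_empty_card:
  assumes "finite S" "finite T" "card S = card T"
  shows "opt_deficiency k T r {#} = opt_deficiency k S r {#}"
proof -
  obtain f where "bij_betw f S T" using assms finite_same_card_bij by blast
  then show ?thesis using opt_deficiency_iso[of S S f "{#}" "{#}" k r] assms(1)
    by (auto simp: bij_betw_def)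
qed

section \<open>Playing in blocks\<close>

text \<open>
  By AM-GM, \<open>leftover p c m r\<close> bounds the mean number of the \<open>r\<close> rounds budgeted for a block
  that remain unused when each of \<open>m\<close> rounds hits the block with probability \<open>p\<close>:
  \<open>(r - pm)\<^sup>2 + mp(1 - p)\<close> is the second moment of \<open>r\<close> minus the number of hits.
\<close>

definition leftover :: "real \<Rightarrow> real \<Rightarrow> nat \<Rightarrow> nat \<Rightarrow> real" where
  "leftover p c m r = ((r - p * m)\<^sup>2 + m * p * (1 - p)) / (2 * c) + c / 2"

text \<open>Conditioning on the first of \<open>Suc m\<close> rounds: with probability
  \<open>p\<close> it hits the block and consumes one unit of budget.\<close>

lemma leftover_step:
  assumes "c > 0"
  shows "leftover p c m (Suc r) + p * (leftover p c m r - leftover p c m (Suc r)) =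
    leftover p c (Suc m) (Suc r)"
  using assms by (simp add: leftover_def field_simps power2_eq_square)

text \<open>This replaces the recursion once the budget is exhausted: a further hit is wasted, and
  the bound must merely not decrease.\<close>

lemma leftover_zero_mono:
  assumes "c > 0" "0 \<le> p" "p \<le> 1"
  shows "leftover p c m 0 \<le> leftover p c (Suc m) 0"
proof -
  have "(p * m)\<^sup>2 \<le> (p * Suc m)\<^sup>2" "m * p * (1 - p) \<le> Suc m * p * (1 - p)"
    using assms by (auto intro!: power_mono mult_mono)
  then show ?thesis using assms by (auto simp: leftover_def intro!: divide_right_mono add_mono)
qed

lemma le_leftover_zero:
  assumes "c > 0"
  shows "r \<le> leftover p c 0 r"
proof -
  have "0 \<le> (r - c)\<^sup>2" by simp
  then have "2 * c * r \<le> r\<^sup>2 + c\<^sup>2" by (simp add: power2_diff mult.commute mult.left_commute)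
  then show ?thesis using assms by (simp add: leftover_def field_simps power2_eq_square)
qed

text \<open>The last term charges the full \<open>k\<close> to each vertex in no block.\<close>

lemma deficiency_blocks_le:
  assumes "finite S" "finite I" "disjoint_family_on A I" "\<And>i. i \<in> I \<Longrightarrow> A i \<subseteq> S"
    and "\<And>i. i \<in> I \<Longrightarrow> card (A i) = q"
  shows "deficiency k S G \<le>
    (\<Sum>i\<in>I. deficiency k (A i) G) + k * (real (card S) - card I * q)"
proof -
  let ?U = "\<Union>i\<in>I. A i"
  have fin: "finite (A i)" if "i \<in> I" for i
    using assms that finite_subset by blast
  have sub: "?U \<subseteq> S" using assms by auto
  have finU: "finite ?U" using sub assms(1) finite_subset by blast
  have cardU: "card ?U = card I * q"
    using assms fin by (subst card_UN_disjoint') auto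
  have "deficiency k S G = deficiency k ?U G + deficiency k (S - ?U) G"
    unfolding deficiency_def using sum.subset_diff[OF sub assms(1)] by (simp add: add.commute)
  also have "deficiency k ?U G = (\<Sum>i\<in>I. deficiency k (A i) G)"
    unfolding deficiency_def using assms fin
    by (intro sum.UNION_disjoint) (auto simp: disjoint_family_on_def)
  also have "deficiency k (S - ?U) G \<le> k * real (card (S - ?U))"
    using deficiency_le by simp
  also have "real (card (S - ?U)) = real (card S) - card I * q"
    using card_Diff_subset[OF finU sub] card_mono[OF assms(1) sub] cardU
    by (simp add: of_nat_diff)
  finally show ?thesis by simp
qed

text \<open>
  Builder answers a vertex of block \<open>A i\<close> optimally within that block as long as the budget
  \<open>r i\<close> of the block lasts, and wastes the round otherwise.
\<close>

lemma opt_deficiency_blocks_le: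
  assumes S: "finite S" "S \<noteq> {}" and I: "finite I" and disj: "disjoint_family_on A I"
    and sub: "\<And>i. i \<in> I \<Longrightarrow> A i \<subseteq> S" and card: "\<And>i. i \<in> I \<Longrightarrow> card (A i) = q"
    and q: "q > 0" "q \<le> card S" and c: "c > 0" and p: "p = q / card S"
  shows "opt_deficiency k S m G \<le>
    (\<Sum>i\<in>I. opt_deficiency k (A i) (r i) G + 2 * leftover p c m (r i))
    + k * (real (card S) - card I * q)"
proof (induction m arbitrary: r G)
  case 0
  \<comment> \<open>A budgeted round that is never played could have removed at most 2 from the
    deficiency of its block; hence the factor 2.\<close>
  have "deficiency k (A i) G \<le> opt_deficiency k (A i) (r i) G + 2 * leftover p c 0 (r i)"
    if "i \<in> I" for i
  proof -
    have "finite (A i)" "A i \<noteq> {}" using that sub card q S finite_subset by fastforce+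
    then show ?thesis
      using deficiency_le_opt_deficiency[of "A i" k G "r i"] le_leftover_zero[OF c, of "r i" p]
      by linarith
  qed
  then have "(\<Sum>i\<in>I. deficiency k (A i) G) \<le>
      (\<Sum>i\<in>I. opt_deficiency k (A i) (r i) G + 2 * leftover p c 0 (r i))"
    by (rule sum_mono)
  then show ?case using deficiency_blocks_le[OF S(1) I disj sub card, of k G] by simp
next
  case (Suc m)
  let ?R = "k * (real (card S) - card I * q)"
  let ?B = "\<lambda>r G i. opt_deficiency k (A i) (r i) G + 2 * leftover p c m (r i)"
  let ?M = "\<lambda>v. Min ((\<lambda>u. opt_deficiency k S m (add_mset (Upair u v) G)) ` S)"
  let ?N = "\<lambda>i v. Min ((\<lambda>u. opt_deficiency k (A i) (r i - 1) (add_mset (Upair u v) G)) ` A i)"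
  define P where "P = (\<Sum>i\<in>I. ?B r G i) + ?R"
  \<comment> \<open>Change in the contribution of block \<open>i\<close> when its vertex
    \<open>v\<close> is offered, with \<open>leftover\<close> still taken at \<open>m\<close>. It is
    0 for an exhausted budget, where the round is wasted.\<close>
  define gain where "gain i v = (if r i = 0 then 0 else
      ?N i v + 2 * leftover p c m (r i - 1) - ?B r G i)" for i v
  have finA: "finite (A i)" "A i \<noteq> {}" if "i \<in> I" for i
    using that sub card q S finite_subset by fastforce+
  have cS: "card S > 0" using S by (simp add: card_gt_0_iff)
  have p01: "0 \<le> p" "p \<le> 1" using p q cS by auto
  have step: "?M v \<le> P + (\<Sum>i\<in>I. if v \<in> A i then gain i v else 0)" if v: "v \<in> S" for v
  proof (cases "\<exists>i\<in>I. v \<in> A i \<and> r i > 0")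
    case True
    then obtain i where i: "i \<in> I" "v \<in> A i" "r i > 0" by auto
    have other: "v \<notin> A j" if "j \<in> I" "j \<noteq> i" for j
      using disj i that by (auto simp: disjoint_family_on_def)
    have gi: "(\<Sum>j\<in>I. if v \<in> A j then gain j v else 0) = gain i v"
      using I i other by (subst sum.remove[of I i]) (auto intro!: sum.neutral)
    have "?N i v \<in> (\<lambda>u. opt_deficiency k (A i) (r i - 1) (add_mset (Upair u v) G)) ` A i"
      using finA i by (intro Min_in) auto
    then obtain u where u: "u \<in> A i"
      "?N i v = opt_deficiency k (A i) (r i - 1) (add_mset (Upair u v) G)" by auto
    have "?M v \<le> opt_deficiency k S m (add_mset (Upair u v) G)"
      using S u sub i by (intro Min_le) auto
    also have "\<dots> \<le> (\<Sum>j\<in>I. ?B (r(i := r i - 1)) (add_mset (Upair u v) G) j) + ?R"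
      by (rule Suc.IH)
    also have "(\<Sum>j\<in>I. ?B (r(i := r i - 1)) (add_mset (Upair u v) G) j) =
        (?N i v + 2 * leftover p c m (r i - 1)) +
        (\<Sum>j\<in>I - {i}. ?B (r(i := r i - 1)) (add_mset (Upair u v) G) j)"
      using I i u by (subst sum.remove[of I i]) auto
    also have "(\<Sum>j\<in>I - {i}. ?B (r(i := r i - 1)) (add_mset (Upair u v) G) j) =
        (\<Sum>j\<in>I - {i}. ?B r G j)"
    proof (intro sum.cong refl)
      fix j assume j: "j \<in> I - {i}"
      have "A i \<inter> A j = {}" using disj i j by (auto simp: disjoint_family_on_def)
      then have "opt_deficiency k (A j) (r j) (add_mset (Upair u v) G) =
          opt_deficiency k (A j) (r j) G"
        using finA j u i by (intro opt_deficiency_cong) (auto simp: neighbours_add_edge)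
      then show "?B (r(i := r i - 1)) (add_mset (Upair u v) G) j = ?B r G j" using j by simp
    qed
    also have "(\<Sum>j\<in>I - {i}. ?B r G j) = P - ?R - ?B r G i"
      using I i sum.remove[of I i "?B r G"] by (simp add: P_def)
    finally show ?thesis using i by (simp add: gi gain_def)
  next
    case False
    then have g0: "(\<Sum>j\<in>I. if v \<in> A j then gain j v else 0) = 0"
      by (intro sum.neutral) (auto simp: gain_def)
    \<comment> \<open>A loop adds no neighbour: this is the wasted round.\<close>
    have "?M v \<le> opt_deficiency k S m (add_mset (Upair v v) G)"
      using S v by (intro Min_le) auto
    also have "\<dots> \<le> opt_deficiency k S m G" by (rule opt_deficiency_lipschitz[OF S])
    also have "\<dots> \<le> P" unfolding P_def by (rule Suc.IH)
    finally show ?thesis using g0 by simp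
  qed
  \<comment> \<open>By the recursion the optimal answers in \<open>A i\<close> average to the
    current value of the block, so only the change of \<open>leftover\<close> remains.\<close>
  have gain_sum: "(\<Sum>v\<in>A i. gain i v) =
      card S * (2 * (leftover p c m (r i) + p * (leftover p c m (r i - 1) - leftover p c m (r i)) -
        leftover p c m (r i)))" if i: "i \<in> I" "r i > 0" for i
  proof -
    obtain s where s: "r i = Suc s" using i by (cases "r i") auto
    have "(\<Sum>v\<in>A i. ?N i v) = q * opt_deficiency k (A i) (r i) G"
      using s q card[OF i(1)] by simp
    then have "(\<Sum>v\<in>A i. gain i v) = q * (2 * (leftover p c m (r i - 1) - leftover p c m (r i)))"
      using i card[OF i(1)] by (simp add: gain_def sum.distrib sum_subtractf algebra_simps)
    also have "real q = card S * p" using p cS by simp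
    finally show ?thesis by (simp add: algebra_simps)
  qed
  have gain_le: "(\<Sum>v\<in>A i. gain i v) \<le>
      card S * (2 * (leftover p c (Suc m) (r i) - leftover p c m (r i)))" if i: "i \<in> I" for i
  proof (cases "r i")
    case 0
    then show ?thesis using leftover_zero_mono[OF c p01, of m] by (simp add: gain_def)
  next
    case (Suc s)
    then show ?thesis
      using gain_sum[OF i] leftover_step[OF c, of p m s] by simp
  qed
  have "(\<Sum>v\<in>S. ?M v) \<le> (\<Sum>v\<in>S. P + (\<Sum>i\<in>I. if v \<in> A i then gain i v else 0))"
    by (intro sum_mono step)
  also have "\<dots> = card S * P + (\<Sum>i\<in>I. \<Sum>v\<in>S. if v \<in> A i then gain i v else 0)"
    by (simp add: sum.distrib sum.swap[of _ I S])
  also have "(\<Sum>i\<in>I. \<Sum>v\<in>S. if v \<in> A i then gain i v else 0) = (\<Sum>i\<in>I. \<Sum>v\<in>A i. gain i v)"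
  proof (rule sum.cong[OF refl])
    fix i assume "i \<in> I"
    then have "S \<inter> A i = A i" using sub by auto
    then show "(\<Sum>v\<in>S. if v \<in> A i then gain i v else 0) = (\<Sum>v\<in>A i. gain i v)"
      using sum.inter_restrict[OF S(1), of "\<lambda>v. gain i v" "A i"] by simp
  qed
  also have "\<dots> \<le> (\<Sum>i\<in>I. card S * (2 * (leftover p c (Suc m) (r i) - leftover p c m (r i))))"
    by (intro sum_mono gain_le)
  also have "\<dots> = card S * (\<Sum>i\<in>I. 2 * (leftover p c (Suc m) (r i) - leftover p c m (r i)))"
    by (simp add: sum_distrib_left)
  finally have "opt_deficiency k S (Suc m) G \<le>
      P + (\<Sum>i\<in>I. 2 * (leftover p c (Suc m) (r i) - leftover p c m (r i)))"
    using cS by (simp add: field_simps)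
  also have "\<dots> = (\<Sum>i\<in>I. opt_deficiency k (A i) (r i) G + 2 * leftover p c (Suc m) (r i)) + ?R"
    by (simp add: P_def sum.distrib sum_subtractf sum_distrib_left right_diff_distrib)
  finally show ?case .
qed

lemma of_nat_nat_ceiling_le:
  fixes x :: real
  assumes "0 \<le> x"
  shows "real (nat \<lceil>x\<rceil>) \<le> x + 1"
  using assms of_int_ceiling_le_add_one[of x] by simp

text \<open>The blocks are consecutive intervals of length \<open>q\<close> with budget
  \<open>r\<close> each; the number of rounds makes the mean number of hits per block about
  \<open>r\<close>. The summand \<open>k * q\<close> pays for the vertices left over.\<close>

lemma opt_deficiency_scale_le:
  assumes q: "0 < q" "q \<le> n"
  shows "opt_deficiency k {1..n} (nat \<lceil>r / q * n\<rceil>) {#} \<le>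
    (opt_deficiency k {1..q} r {#} + 2 * sqrt (real r + 2)) / q * n + k * q"
proof -
  define a where "a = n div q"
  define m where "m = nat \<lceil>r / q * n\<rceil>"
  \<comment> \<open>The mean number of hits is within 1 of \<open>r\<close> and the variance at most
    \<open>r + 1\<close>, so the second moment in \<open>leftover\<close> is at most
    \<open>r + 2\<close>; this \<open>c\<close> optimises the AM-GM bound, whose value is then
    \<open>c\<close>.\<close>
  define c where "c = sqrt (real r + 2)"
  define p where "p = real q / real n"
  define A where "A i = {i * q + 1..i * q + q}" for i
  have c: "c > 0" "c\<^sup>2 = r + 2" by (auto simp: c_def)
  have aq: "a * q \<le> n" "n \<le> a * q + q"
    using div_mult_mod_eq[of n q] mod_less_divisor[of q n] q unfolding a_def by linarith+
  have sub: "A i \<subseteq> {1..n}" if "i \<in> {..<a}" for i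
  proof -
    have "Suc i * q \<le> a * q" using that by (intro mult_le_mono1) auto
    then show ?thesis using aq by (auto simp: A_def)
  qed
  have "A i \<inter> A j = {}" if "i < j" for i j
  proof -
    have "Suc i * q \<le> j * q" using that by (intro mult_le_mono1) auto
    then show ?thesis by (auto simp: A_def)
  qed
  then have disj: "disjoint_family_on A {..<a}"
    unfolding disjoint_family_on_def by (metis inf_commute nat_neq_iff)
  have "opt_deficiency k {1..n} m {#} \<le>
      (\<Sum>i<a. opt_deficiency k (A i) r {#} + 2 * leftover p c m r) +
      k * (real (card {1..n}) - card {..<a} * q)"
    using q sub disj c by (intro opt_deficiency_blocks_le) (simp_all add: p_def, simp add: A_def)
  also have "(\<Sum>i<a. opt_deficiency k (A i) r {#} + 2 * leftover p c m r) =
      a * (opt_deficiency k {1..q} r {#} + 2 * leftover p c m r)"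
    using opt_deficiency_empty_card[of "{1..q}" "A _" k r] by (simp add: A_def)
  also have "\<dots> \<le> n / q * (opt_deficiency k {1..q} r {#} + 2 * c)"
  proof (rule mult_mono)
    show "real a \<le> n / q" unfolding a_def by (rule of_nat_div_le_of_nat)
    have mm: "r / q * n \<le> m" "m \<le> r / q * n + 1"
      unfolding m_def by (rule of_nat_ceiling, rule of_nat_nat_ceiling_le) simp
    have p: "p * (r / q * n) = r" "p \<le> 1" "0 \<le> p" using q by (auto simp: p_def)
    have pm: "r \<le> p * m" "p * m \<le> r + 1"
      using mult_left_mono[OF mm(1) p(3)] mult_left_mono[OF mm(2) p(3)] p
      by (simp_all only: distrib_left)
    have "(r - p * m)\<^sup>2 \<le> 1" using pm by (auto simp: abs_square_le_1)
    moreover have "m * p * (1 - p) \<le> (real r + 1) * 1"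
      using pm p by (intro mult_mono) (auto simp: mult.commute)
    ultimately have "leftover p c m r \<le> (r + 2) / (2 * c) + c / 2"
      unfolding leftover_def using c by (intro add_right_mono divide_right_mono) auto
    also have "\<dots> = c" using c by (simp add: field_simps power2_eq_square)
    finally show "opt_deficiency k {1..q} r {#} + 2 * leftover p c m r \<le>
        opt_deficiency k {1..q} r {#} + 2 * c" by simp
    have "leftover p c m r \<ge> 0"
      using c p by (auto simp: leftover_def
          intro!: add_nonneg_nonneg divide_nonneg_nonneg)
    then show "0 \<le> opt_deficiency k {1..q} r {#} + 2 * leftover p c m r"
      using opt_deficiency_nonneg[of "{1..q}" k r "{#}"] q by auto
  qed auto
  also have "k * (real (card {1..n}) - card {..<a} * q) \<le> k * real q"
  proof (rule mult_left_mono)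
    have "real n \<le> real (a * q + q)" using aq by (simp only: of_nat_le_iff)
    then show "real (card {1..n}) - card {..<a} * q \<le> q" by simp
  qed auto
  finally show ?thesis by (simp add: m_def c_def field_simps)
qed


section \<open>Concentration\<close>

lemma finite_set_pmf_semi_random:
  assumes "strategy_on n \<sigma>" "n > 0"
  shows "finite (set_pmf (semi_random n \<sigma> t))"
proof (induction t)
  case (Suc t)
  have "finite (set_pmf (\<sigma> h v))" for h v
    using assms(1) finite_subset unfolding strategy_on_def by (metis finite_atLeastAtMost)
  then show ?case using Suc assms(2) by simp
qed simp

lemma length_semi_random: "h \<in> set_pmf (semi_random n \<sigma> t) \<Longrightarrow> length h = t"
  by (induction t arbitrary: h) auto

text \<open>Drift inequality: \<open>g v\<close> dominates \<open>f\<close> at every answer the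
  strategy may draw, so randomised answers are absorbed and only the average over the offered vertex
  needs checking.\<close>

lemma expectation_semi_random_le:
  fixes f :: "nat \<Rightarrow> history \<Rightarrow> real"
  assumes "strategy_on n \<sigma>" "n > 0"
    and step: "\<And>t h. t < m \<Longrightarrow> length h = t \<Longrightarrow>
      \<exists>g. (\<forall>v\<in>{1..n}. \<forall>u\<in>set_pmf (\<sigma> h v). f (Suc t) (h @ [(u, v)]) \<le> g v) \<and>
        (\<Sum>v=1..n. g v) / n \<le> f t h + c"
  shows "measure_pmf.expectation (semi_random n \<sigma> m) (f m) \<le> f 0 [] + c * m"
proof -
  have "t \<le> m \<Longrightarrow> measure_pmf.expectation (semi_random n \<sigma> t) (f t) \<le> f 0 [] + c * t" for t
  proof (induction t)
    case (Suc t)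
    have fin: "finite (set_pmf (\<sigma> h v))" for h v
      using assms(1) finite_subset unfolding strategy_on_def by (metis finite_atLeastAtMost)
    let ?p = "semi_random n \<sigma> t"
    let ?q = "\<lambda>h. bind_pmf (pmf_of_set {1..n}) (\<lambda>v.
        bind_pmf (\<sigma> h v) (\<lambda>u. return_pmf (h @ [(u, v)])))"
    have fp: "finite (set_pmf ?p)" by (rule finite_set_pmf_semi_random[OF assms(1,2)])
    have le: "measure_pmf.expectation (?q h) (f (Suc t)) \<le> f t h + c" if h: "h \<in> set_pmf ?p" for h
    proof -
      obtain g where g: "\<And>v u. v \<in> {1..n} \<Longrightarrow> u \<in> set_pmf (\<sigma> h v) \<Longrightarrow> f (Suc t) (h @ [(u, v)]) \<le> g v"
        "(\<Sum>v=1..n. g v) / n \<le> f t h + c"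
        using step[OF _ length_semi_random[OF h]] Suc.prems unfolding Suc_le_eq by blast
      have le_g: "measure_pmf.expectation (map_pmf (\<lambda>u. h @ [(u, v)]) (\<sigma> h v)) (f (Suc t)) \<le> g v"
        if "v \<in> {1..n}" for v
      proof -
        have "measure_pmf.expectation (\<sigma> h v) (\<lambda>u. f (Suc t) (h @ [(u, v)])) \<le>
            measure_pmf.expectation (\<sigma> h v) (\<lambda>u. g v)"
          using g(1)[OF that] fin
          by (intro integral_mono_AE integrable_measure_pmf_finite) (auto simp: AE_measure_pmf_iff)
        then show ?thesis by simp
      qed
      have "measure_pmf.expectation (?q h) (f (Suc t)) =
          (\<Sum>v=1..n. measure_pmf.expectation (map_pmf (\<lambda>u. h @ [(u, v)]) (\<sigma> h v)) (f (Suc t)) / n)"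
        using fin assms(2) unfolding map_pmf_def
        by (subst pmf_expectation_bind[where A = "{1..n}"]) (auto simp: divide_simps)
      also have "\<dots> \<le> (\<Sum>v=1..n. g v / n)"
        using le_g by (intro sum_mono divide_right_mono) auto
      finally show ?thesis using g(2) by (simp add: sum_divide_distrib)
    qed
    have "measure_pmf.expectation (semi_random n \<sigma> (Suc t)) (f (Suc t)) =
        (\<Sum>h\<in>set_pmf ?p. pmf ?p h * measure_pmf.expectation (?q h) (f (Suc t)))"
      using fp fin assms(2) by (simp only: semi_random.simps, subst pmf_expectation_bind) auto
    also have "\<dots> \<le> (\<Sum>h\<in>set_pmf ?p. pmf ?p h * (f t h + c))"
      by (intro sum_mono mult_left_mono le) auto
    also have "\<dots> = measure_pmf.expectation ?p (\<lambda>h. f t h + c)"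
      using fp by (subst integral_measure_pmf_real[where A = "set_pmf ?p"]) (auto simp: mult.commute)
    also have "\<dots> = measure_pmf.expectation ?p (f t) + c"
      using fp by (subst Bochner_Integration.integral_add)
        (auto intro: integrable_measure_pmf_finite)
    finally show ?case using Suc by (simp add: algebra_simps)
  qed simp
  then show ?thesis by simp
qed

text \<open>Markov's inequality, kept as a product so that \<open>b = 0\<close> is allowed.\<close>

lemma prob_mult_le_expectation:
  fixes f :: "'a \<Rightarrow> real"
  assumes "finite (set_pmf p)" "\<And>x. 0 \<le> f x" "\<And>x. x \<in> A \<Longrightarrow> b \<le> f x"
  shows "measure_pmf.prob p A * b \<le> measure_pmf.expectation p f"
proof -
  have "measure_pmf.expectation p (\<lambda>x. indicator A x * b) \<le> measure_pmf.expectation p f"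
    using assms by (intro integral_mono integrable_measure_pmf_finite) (auto simp: indicator_def)
  then show ?thesis by simp
qed

lemma graph_of_snoc: "graph_of (h @ [(u, v)]) = add_mset (Upair u v) (graph_of h)"
  by (simp add: graph_of_def)

text \<open>Second-order Taylor bound: the squared positive part has derivative
  \<open>2 * max 0 x\<close> and second derivative at most 2. The linear term is kept because the
  martingale property controls its average.\<close>

lemma positive_part_square_le:
  fixes x y :: real
  assumes "\<bar>y\<bar> \<le> 2"
  shows "(max 0 (x + y))\<^sup>2 \<le> (max 0 x)\<^sup>2 + 2 * max 0 x * y + 4"
proof -
  have y: "y\<^sup>2 \<le> 4" using assms abs_le_square_iff[of y 2] by simp
  show ?thesis
  proof (cases "x \<ge> 0")
    case True
    have "(max 0 (x + y))\<^sup>2 \<le> (x + y)\<^sup>2" by (auto simp: max_def)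
    then show ?thesis using True y by (simp add: power2_sum)
  next
    case False
    then have "(max 0 (x + y))\<^sup>2 \<le> y\<^sup>2"
      using abs_le_square_iff[of "max 0 (x + y)" y] by (auto simp: max_def)
    then show ?thesis using False y by simp
  qed
qed

text \<open>
  Against every strategy the optimal expected final deficiency is a submartingale, so its
  downward deviations have variance \<open>O(m)\<close>.
\<close>

lemma prob_success_le:
  assumes "strategy_on n \<sigma>" "n > 0"
  shows "measure_pmf.prob (semi_random n \<sigma> m) {h. min_neighbours k n (graph_of h)} *
    (opt_deficiency k {1..n} m {#})\<^sup>2 \<le> 4 * real m"
proof -
  define a where "a = opt_deficiency k {1..n} m {#}"
  \<comment> \<open>Success requires the optimal value to fall from \<open>a\<close> to 0, where
    \<open>f m\<close> equals \<open>a\<^sup>2\<close>.\<close>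
  define f where "f t h = (max 0 (a - opt_deficiency k {1..n} (m - t) (graph_of h)))\<^sup>2" for t h
  have S: "finite {1..n}" "{1..n} \<noteq> {}" using assms by auto
  have a: "a \<ge> 0" unfolding a_def by (rule opt_deficiency_nonneg[OF S])
  have "measure_pmf.expectation (semi_random n \<sigma> m) (f m) \<le> f 0 [] + 4 * real m"
  proof (rule expectation_semi_random_le[OF assms])
    fix t and h :: history
    assume t: "t < m" "length h = t"
    define r where "r = m - Suc t"
    have r: "m - t = Suc r" "m - Suc t = r" using t by (auto simp: r_def)
    let ?G = "graph_of h"
    define s where "s = opt_deficiency k {1..n} (Suc r) ?G"
    define M where "M v = Min ((\<lambda>u. opt_deficiency k {1..n} r (add_mset (Upair u v) ?G)) ` {1..n})" for v
    define g where "g v = f t h - 2 * max 0 (a - s) * (M v - s) + 4" for v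
    have "f (Suc t) (h @ [(u, v)]) \<le> g v" if "v \<in> {1..n}" "u \<in> set_pmf (\<sigma> h v)" for u v
    proof -
      have u: "u \<in> {1..n}" using that assms(1) unfolding strategy_on_def by blast
      define s' where "s' = opt_deficiency k {1..n} r (add_mset (Upair u v) ?G)"
      have "\<bar>s - s'\<bar> \<le> 2"
        using opt_deficiency_lipschitz(1)[OF S, of k r u v ?G] opt_deficiency_lipschitz(2)[OF S, of k r ?G u v]
        opt_deficiency_Suc[OF S, of k r ?G]
        unfolding s_def s'_def by linarith
      from positive_part_square_le[OF this, of "a - s"]
      have "f (Suc t) (h @ [(u, v)]) \<le> f t h + 2 * max 0 (a - s) * (s - s') + 4"
        by (simp add: f_def r s_def s'_def graph_of_snoc)
      also have "\<dots> \<le> f t h + 2 * max 0 (a - s) * (s - M v) + 4"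
      proof -
        have "M v \<le> s'" unfolding M_def s'_def using u by (intro Min_le) auto
        then show ?thesis by (intro add_mono mult_left_mono) auto
      qed
      finally show ?thesis by (simp add: g_def algebra_simps)
    qed
    moreover have "(\<Sum>v=1..n. g v) / n \<le> f t h + 4"
    proof -
      \<comment> \<open>The recursion makes \<open>M v\<close> average to \<open>s\<close>, so the
        linear term of \<open>g\<close> sums to 0.\<close>
      have "(\<Sum>v=1..n. M v) = n * s" using assms(2) by (simp add: s_def M_def)
      then have "(\<Sum>v=1..n. g v) = n * (f t h + 4)"
        by (simp add: g_def sum.distrib sum_subtractf flip: sum_distrib_left)
          (simp add: algebra_simps)
      then show ?thesis using assms(2) by simp
    qed
    ultimately show "\<exists>g. (\<forall>v\<in>{1..n}. \<forall>u\<in>set_pmf (\<sigma> h v). f (Suc t) (h @ [(u, v)]) \<le> g v) \<and>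
        (\<Sum>v=1..n. g v) / n \<le> f t h + 4" by blast
  qed
  moreover have "f 0 [] = 0" by (simp add: f_def a_def graph_of_def)
  moreover have "measure_pmf.prob (semi_random n \<sigma> m) {h. min_neighbours k n (graph_of h)} * a\<^sup>2 \<le>
      measure_pmf.expectation (semi_random n \<sigma> m) (f m)"
    using a by (intro prob_mult_le_expectation finite_set_pmf_semi_random[OF assms])
      (auto simp: f_def min_neighbours_iff_deficiency)
  ultimately show ?thesis by (simp add: a_def)
qed

section \<open>Repairing deficient vertices\<close>

lemma sum_indicator_subset:
  "finite A \<Longrightarrow> B \<subseteq> A \<Longrightarrow> (\<Sum>x\<in>A. indicator B x :: real) = card B"
  by (simp add: indicator_def sum.If_cases Int_absorb1)

text \<open>Apart from \<open>u\<close> and its at most \<open>k - 1\<close> neighbours, every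
  offered vertex becomes a new neighbour of \<open>u\<close>; these are at least half of all
  vertices.\<close>

lemma deficiency_fill:
  assumes u: "u \<in> {1..n}" "card (neighbours G u) < k" and n: "2 * k \<le> n"
  shows "(\<Sum>v=1..n. deficiency k {1..n} (add_mset (Upair u v) G)) / n \<le>
    deficiency k {1..n} G - 1 / 2"
proof -
  let ?D = "deficiency k {1..n}"
  let ?B = "{1..n} - insert u (neighbours G u)"
  have *: "?D (add_mset (Upair u v) G) \<le> ?D G - indicator ?B v" if "v \<in> {1..n}" for v
  proof (cases "v \<in> ?B")
    case True
    have sub: "card (neighbours G x) \<le> card (neighbours (add_mset (Upair u v) G) x)" for x
      by (intro card_mono finite_neighbours) (auto simp: neighbours_add_edge)
    have cu: "card (neighbours (add_mset (Upair u v) G) u) = Suc (card (neighbours G u))"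
      using True finite_neighbours by (auto simp: neighbours_add_edge)
    have "?D (add_mset (Upair u v) G) \<le>
        (\<Sum>x=1..n. real (k - card (neighbours G x)) - (if x = u then 1 else 0))"
      unfolding deficiency_def
    proof (intro sum_mono)
      fix x assume "x \<in> {1..n}"
      show "real (k - card (neighbours (add_mset (Upair u v) G) x)) \<le>
          real (k - card (neighbours G x)) - (if x = u then 1 else 0)"
        using sub[of x] cu u(2) by (cases "x = u") (auto simp: of_nat_diff)
    qed
    also have "\<dots> = ?D G - 1" using u(1) by (simp add: sum_subtractf deficiency_def)
    finally show ?thesis using True by simp
  next
    case False
    then have "indicator ?B v = (0::real)" by (rule indicator_simps(2))
    then show ?thesis using deficiency_add_edge_le[of k "{1..n}" u v G] by linarith
  qed
  have "card (insert u (neighbours G u)) \<le> k"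
    using u(2) finite_neighbours by (simp add: card_insert_if)
  moreover have "n - card (insert u (neighbours G u)) \<le> card ?B"
    using diff_card_le_card_Diff[of "insert u (neighbours G u)" "{1..n}"] finite_neighbours by simp
  ultimately have cB: "real n / 2 \<le> card ?B" using n by linarith
  have "(\<Sum>v=1..n. ?D (add_mset (Upair u v) G)) \<le> (\<Sum>v=1..n. ?D G - indicator ?B v)"
    by (intro sum_mono *)
  also have "\<dots> = n * ?D G - (\<Sum>v=1..n. indicator ?B v)"
    by (simp only: sum_subtractf sum_constant card_atLeastAtMost diff_Suc_1)
  also have "(\<Sum>v=1..n. indicator ?B v :: real) = card ?B"
    by (rule sum_indicator_subset) auto
  also have "n * ?D G - card ?B \<le> n * ?D G - n / 2" using cB by simp
  finally show ?thesis using u(1) by (simp add: field_simps)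
qed

text \<open>
  For the first \<open>m\<^sub>1\<close> rounds Builder plays optimally for the expected deficiency, which makes
  the optimal expected deficiency a martingale.  Afterwards he serves any deficient vertex, which
  lowers the deficiency by at least 1/2 per round on average.  Either way, \<open>Y\<close> below is a
  supermartingale with bounded increments until the deficiency vanishes.
\<close>

lemma prob_failure_le:
  assumes n: "n > 0" "2 * k \<le> n"
    and a: "a = opt_deficiency k {1..n} m\<^sub>1 {#}" "a \<le> m\<^sub>2 / 2"
  shows "\<exists>\<sigma>. strategy_on n \<sigma> \<and>
    measure_pmf.prob (semi_random n \<sigma> (m\<^sub>1 + m\<^sub>2)) {h. \<not> min_neighbours k n (graph_of h)} *
      (m\<^sub>2 / 2 - a)\<^sup>2 \<le> 4 * real (m\<^sub>1 + m\<^sub>2)"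
proof -
  let ?D = "deficiency k {1..n}"
  let ?W = "opt_deficiency k {1..n}"
  have S: "finite {1..n}" "{1..n} \<noteq> {}" using n by auto
  \<comment> \<open>The term \<open>(t - m\<^sub>1) / 2\<close> compensates the mean gain of 1/2 per
    repair round. At \<open>t = m\<^sub>1\<close> both formulas agree, since the optimal value with
    no rounds left is the deficiency.\<close>
  define Y where "Y t G = (if t \<le> m\<^sub>1 then ?W (m\<^sub>1 - t) G else ?D G + (real t - m\<^sub>1) / 2)" for t G
  have incr: "\<bar>Y (Suc t) (add_mset (Upair u v) G) - Y t G\<bar> \<le> 2" for t u v G
  proof (cases "t < m\<^sub>1")
    case True
    then obtain r where r: "m\<^sub>1 - t = Suc r" "m\<^sub>1 - Suc t = r"
      by (metis Suc_diff_Suc)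
    have "Y (Suc t) (add_mset (Upair u v) G) = ?W r (add_mset (Upair u v) G)"
      "Y t G = ?W (Suc r) G"
      using True r by (simp_all only: Y_def Suc_leI less_imp_le if_True)
    then show ?thesis
      using opt_deficiency_lipschitz(1)[OF S, of k r u v G] opt_deficiency_lipschitz(2)[OF S, of k r G u v]
        opt_deficiency_Suc[OF S, of k r G]
      by linarith
  next
    case False
    then have "Y (Suc t) (add_mset (Upair u v) G) - Y t G =
        ?D (add_mset (Upair u v) G) - ?D G + 1 / 2"
      by (auto simp: Y_def field_simps)
    then show ?thesis
      using deficiency_add_edge_le[of k "{1..n}" u v G] deficiency_le_add_edge[OF S(1), of k G u v]
      by simp
  qed
  have ex: "\<exists>c. (\<forall>v. c v \<in> {1..n}) \<and>
      (?D G > 0 \<longrightarrow> (\<Sum>v=1..n. Y (Suc t) (add_mset (Upair (c v) v) G)) / n \<le> Y t G)" for t G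
  proof (cases "t < m\<^sub>1")
    case True
    then obtain r where r: "m\<^sub>1 - t = Suc r" "m\<^sub>1 - Suc t = r"
      by (metis Suc_diff_Suc)
    let ?g = "\<lambda>v u. ?W r (add_mset (Upair u v) G)"
    have "Min (?g v ` {1..n}) \<in> ?g v ` {1..n}" for v using S by (intro Min_in) auto
    then have "\<forall>v. \<exists>u. u \<in> {1..n} \<and> Min (?g v ` {1..n}) = ?g v u" by blast
    then obtain c where c: "\<forall>v. c v \<in> {1..n} \<and> Min (?g v ` {1..n}) = ?g v (c v)"
      by (rule choice[THEN exE])
    have "Y (Suc t) (add_mset (Upair (c v) v) G) = Min (?g v ` {1..n})" for v
      using True r c by (simp only: Y_def Suc_leI if_True)
    moreover have "Y t G = ?W (Suc r) G"
      using True r by (simp only: Y_def less_imp_le if_True)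
    ultimately show ?thesis using c by (intro exI[of _ c]) simp
  next
    case False
    show ?thesis
    proof (cases "?D G > 0")
      case True
      have "?D G = 0" if "\<forall>u\<in>{1..n}. k \<le> card (neighbours G u)"
        unfolding deficiency_def using that by (intro sum.neutral) simp
      then obtain u where u: "u \<in> {1..n}" "card (neighbours G u) < k"
        using True not_le by fastforce
      have "Y (Suc t) (add_mset (Upair u v) G) =
          ?D (add_mset (Upair u v) G) + (real t + 1 - m\<^sub>1) / 2" for v
        using False by (auto simp: Y_def)
      then have "(\<Sum>v=1..n. Y (Suc t) (add_mset (Upair u v) G)) / n =
          (\<Sum>v=1..n. ?D (add_mset (Upair u v) G)) / n + (real t + 1 - m\<^sub>1) / 2"
        using n by (simp add: sum.distrib add_divide_distrib)
      also have "\<dots> \<le> ?D G - 1 / 2 + (real t + 1 - m\<^sub>1) / 2"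
        using deficiency_fill[OF u n(2)] by (rule add_right_mono)
      also have "\<dots> = Y t G" using False by (auto simp: Y_def field_simps)
      finally show ?thesis using u(1) by (intro exI[of _ "\<lambda>_. u"]) simp
    next
      case False
      then show ?thesis using n by (intro exI[of _ "\<lambda>_. 1"]) auto
    qed
  qed
  define c where "c t G = (SOME c. (\<forall>v. c v \<in> {1..n}) \<and>
      (?D G > 0 \<longrightarrow> (\<Sum>v=1..n. Y (Suc t) (add_mset (Upair (c v) v) G)) / n \<le> Y t G))" for t G
  have c: "c t G v \<in> {1..n}"
    "?D G > 0 \<Longrightarrow> (\<Sum>v=1..n. Y (Suc t) (add_mset (Upair (c t G v) v) G)) / n \<le> Y t G" for t G v
    using someI_ex[OF ex, of G t] unfolding c_def by simp_all
  define \<sigma> where "\<sigma> h v = return_pmf (c (length h) (graph_of h) v)" for h v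
  have \<sigma>: "strategy_on n \<sigma>" using c(1) by (simp add: strategy_on_def \<sigma>_def)
  \<comment> \<open>The value 0 stops the process once the deficiency vanishes: \<open>c\<close>
    guarantees the drift only while it is positive, and a vanished deficiency never returns.\<close>
  define f where "f t h = (if ?D (graph_of h) = 0 then 0 else (max 0 (Y t (graph_of h) - a))\<^sup>2)"
    for t h
  let ?p = "semi_random n \<sigma> (m\<^sub>1 + m\<^sub>2)"
  have "measure_pmf.expectation ?p (f (m\<^sub>1 + m\<^sub>2)) \<le> f 0 [] + 4 * real (m\<^sub>1 + m\<^sub>2)"
  proof (rule expectation_semi_random_le[OF \<sigma> n(1)])
    fix t and h :: history
    assume t: "length h = t"
    let ?G = "graph_of h"
    let ?y = "\<lambda>v. Y (Suc t) (add_mset (Upair (c t ?G v) v) ?G)"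
    have set\<sigma>: "set_pmf (\<sigma> h v) = {c t ?G v}" for v by (simp add: \<sigma>_def t)
    show "\<exists>g. (\<forall>v\<in>{1..n}. \<forall>u\<in>set_pmf (\<sigma> h v). f (Suc t) (h @ [(u, v)]) \<le> g v) \<and>
        (\<Sum>v=1..n. g v) / n \<le> f t h + 4"
    proof (cases "?D ?G = 0")
      case True
      have "?D (add_mset (Upair u v) ?G) = 0" for u v
        using True deficiency_add_edge_le[of k "{1..n}" u v ?G] deficiency_nonneg
        by (metis antisym)
      then show ?thesis
        by (intro exI[of _ "\<lambda>_. 0"]) (simp add: f_def graph_of_snoc)
    next
      case False
      then have pos: "?D ?G > 0" using deficiency_nonneg[of k "{1..n}" ?G] by simp
      define x where "x = Y t ?G - a"
      have fx: "f t h = (max 0 x)\<^sup>2" using False by (simp add: f_def x_def)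
      define g where "g v = f t h + 2 * max 0 x * (?y v - Y t ?G) + 4" for v
      have "f (Suc t) (h @ [(c t ?G v, v)]) \<le> g v" for v
      proof -
        have "f (Suc t) (h @ [(c t ?G v, v)]) \<le> (max 0 (x + (?y v - Y t ?G)))\<^sup>2"
          by (simp add: f_def graph_of_snoc x_def)
        also have "\<dots> \<le> (max 0 x)\<^sup>2 + 2 * max 0 x * (?y v - Y t ?G) + 4"
          by (rule positive_part_square_le[OF incr])
        finally show ?thesis by (simp only: g_def fx)
      qed
      moreover have "(\<Sum>v=1..n. g v) / n \<le> f t h + 4"
      proof -
        have "(\<Sum>v=1..n. g v) = n * (f t h + 4) + 2 * max 0 x * ((\<Sum>v=1..n. ?y v) - n * Y t ?G)"
          unfolding g_def by (simp add: sum.distrib sum_subtractf algebra_simps flip: sum_distrib_left)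
        moreover have "(\<Sum>v=1..n. ?y v) - n * Y t ?G \<le> 0"
          using c(2)[OF pos, of t] n by (simp add: field_simps)
        ultimately have "(\<Sum>v=1..n. g v) \<le> n * (f t h + 4)"
          by (simp add: mult_nonneg_nonpos)
        then show ?thesis using n by (simp add: field_simps)
      qed
      ultimately show ?thesis by (intro exI[of _ g]) (simp add: set\<sigma>)
    qed
  qed
  moreover have "f 0 [] = 0" by (simp add: f_def Y_def a graph_of_def)
  moreover have "measure_pmf.prob ?p {h. \<not> min_neighbours k n (graph_of h)} * (m\<^sub>2 / 2 - a)\<^sup>2 \<le>
      measure_pmf.expectation ?p (f (m\<^sub>1 + m\<^sub>2))"
  proof (intro prob_mult_le_expectation finite_set_pmf_semi_random[OF \<sigma> n(1)])
    fix h :: history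
    assume "h \<in> {h. \<not> min_neighbours k n (graph_of h)}"
    then have D: "?D (graph_of h) \<noteq> 0" by (simp add: min_neighbours_iff_deficiency)
    have "Y (m\<^sub>1 + m\<^sub>2) (graph_of h) = ?D (graph_of h) + m\<^sub>2 / 2"
      by (simp add: Y_def)
    then have "m\<^sub>2 / 2 - a \<le> Y (m\<^sub>1 + m\<^sub>2) (graph_of h) - a"
      using deficiency_nonneg[of k "{1..n}" "graph_of h"] by linarith
    then show "(m\<^sub>2 / 2 - a)\<^sup>2 \<le> f (m\<^sub>1 + m\<^sub>2) h"
      using D a(2) by (simp add: f_def)
  qed (simp add: f_def)
  ultimately show ?thesis using \<sigma> by (intro exI[of _ \<sigma>]) simp
qed

section \<open>The threshold\<close>

abbreviation final_deficiency :: "nat \<Rightarrow> nat \<Rightarrow> nat \<Rightarrow> real" where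
  "final_deficiency k n m \<equiv> opt_deficiency k {1..n} m {#}"

definition good_rate :: "nat \<Rightarrow> real \<Rightarrow> bool" where
  "good_rate k x \<longleftrightarrow> (\<forall>\<epsilon>>0::real. \<forall>\<^sub>F n in sequentially.
     final_deficiency k n (nat \<lceil>x * n\<rceil>) \<le> \<epsilon> * n)"

lemma final_deficiency_antimono:
  "n > 0 \<Longrightarrow> l \<le> m \<Longrightarrow> final_deficiency k n m \<le> final_deficiency k n l"
  by (rule opt_deficiency_antimono) auto

text \<open>Each round removes at most 2 from the initial deficiency \<open>k * n\<close>. This will
  make the threshold positive.\<close>

lemma good_rate_ge:
  assumes "0 \<le> x" "good_rate k x"
  shows "k / 2 \<le> x"
proof (rule ccontr)
  assume "\<not> k / 2 \<le> x"
  then have e: "k - 2 * x > 0" by simp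
  \<comment> \<open>With half the gap, \<open>\<epsilon> * n\<close> would have to be covered by the
    rounding error 2, which fails for large \<open>n\<close>.\<close>
  define \<epsilon> where "\<epsilon> = (k - 2 * x) / 2"
  have \<epsilon>: "\<epsilon> > 0" using e by (simp add: \<epsilon>_def)
  then have "\<forall>\<^sub>F n in sequentially. final_deficiency k n (nat \<lceil>x * n\<rceil>) \<le> \<epsilon> * n"
    using assms by (simp add: good_rate_def)
  moreover have "\<forall>\<^sub>F n::nat in sequentially. 2 < \<epsilon> * n" using \<epsilon> by real_asymp
  moreover have "\<forall>\<^sub>F n::nat in sequentially. 0 < n" by (rule eventually_gt_at_top)
  ultimately have "\<forall>\<^sub>F n::nat in sequentially. False"
  proof eventually_elim
    case (elim n)
    define m where "m = nat \<lceil>x * n\<rceil>"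
    have m: "m \<le> x * n + 1"
      unfolding m_def using assms(1) by (intro of_nat_nat_ceiling_le) simp
    have "k * real n \<le> final_deficiency k n m + 2 * real m"
      using deficiency_le_opt_deficiency[of "{1..n}" k "{#}" m] elim
      by (simp add: deficiency_empty)
    then have "k * real n \<le> \<epsilon> * n + 2 * (x * n) + 2" using elim(1) m unfolding m_def[symmetric] by linarith
    moreover have "k * real n = \<epsilon> * n + \<epsilon> * n + 2 * (x * n)" by (simp add: \<epsilon>_def algebra_simps)
    ultimately show ?case using elim by linarith
  qed
  then show False by simp
qed

text \<open>The mean repair over \<open>4 * k * n\<close> rounds would be twice the initial
  deficiency, so for large \<open>n\<close> pure repair succeeds with probability at least 1/2. Read
  backwards, \<open>prob_success_le\<close> then forces the optimal final deficiency to be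
  \<open>O(sqrt n)\<close>.\<close>

lemma good_rate_exists:
  assumes "k \<ge> 1"
  shows "good_rate k (4 * k)"
  unfolding good_rate_def
proof (intro allI impI)
  fix \<epsilon> :: real
  assume \<epsilon>: "\<epsilon> > 0"
  have "\<forall>\<^sub>F n::nat in sequentially. 32 * k / \<epsilon>\<^sup>2 < n" by real_asymp
  moreover have "\<forall>\<^sub>F n::nat in sequentially. 32 * k \<le> n" by (rule eventually_ge_at_top)
  ultimately show "\<forall>\<^sub>F n in sequentially. final_deficiency k n (nat \<lceil>real (4 * k) * n\<rceil>) \<le> \<epsilon> * n"
  proof eventually_elim
    case (elim n)
    have n: "n > 0" "2 * k \<le> n" using elim assms by auto
    define m where "m = 4 * k * n"
    have m: "nat \<lceil>real (4 * k) * n\<rceil> = m"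
      by (simp add: m_def flip: of_nat_mult)
    have a: "final_deficiency k n 0 = k * n" by (simp add: deficiency_empty)
    obtain \<sigma> where \<sigma>: "strategy_on n \<sigma>"
      "measure_pmf.prob (semi_random n \<sigma> (0 + m)) {h. \<not> min_neighbours k n (graph_of h)} *
        (m / 2 - k * n)\<^sup>2 \<le> 4 * real (0 + m)"
      using prob_failure_le[OF n, of "k * n" 0 m] a by (auto simp: m_def)
    let ?P = "measure_pmf.prob (semi_random n \<sigma> m)"
    let ?A = "{h. min_neighbours k n (graph_of h)}"
    define K where "K = real (k * n)"
    have K: "K > 0" using n assms by (simp add: K_def)
    have "?P (- ?A) * K\<^sup>2 \<le> 16 * K"
      using \<sigma>(2) by (simp add: m_def K_def Collect_neg_eq)
    then have "(?P (- ?A) * K) * K \<le> 16 * K"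
      by (simp only: power2_eq_square mult.assoc)
    then have "?P (- ?A) * K \<le> 16" using K by (rule mult_right_le_imp_le)
    moreover have "32 \<le> K"
    proof -
      have "32 \<le> n" using elim(2) assms by linarith
      then have "32 \<le> k * n" using mult_le_mono[of 1 k 32 n] assms by simp
      then show ?thesis unfolding K_def by linarith
    qed
    ultimately have "?P (- ?A) \<le> 1 / 2"
      using mult_left_mono[of 32 K "?P (- ?A)"] by simp
    then have half: "1 / 2 \<le> ?P ?A"
      using measure_pmf.prob_compl[of ?A "semi_random n \<sigma> m"] by (simp add: Compl_eq_Diff_UNIV)
    let ?e = "final_deficiency k n m"
    have "?e\<^sup>2 / 2 \<le> ?P ?A * ?e\<^sup>2" using mult_right_mono[OF half, of "?e\<^sup>2"] by simp
    also have "\<dots> \<le> 4 * real m" by (rule prob_success_le[OF \<sigma>(1) n(1)])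
    finally have "?e\<^sup>2 \<le> real (32 * k) * n" by (simp add: m_def)
    also have "\<dots> \<le> (\<epsilon>\<^sup>2 * n) * n"
    proof (rule mult_right_mono)
      have "32 * real k < n * \<epsilon>\<^sup>2" using elim(1) \<epsilon>
        by (simp only: pos_divide_less_eq zero_less_power of_nat_mult of_nat_numeral)
      then show "real (32 * k) \<le> \<epsilon>\<^sup>2 * n" by (simp add: mult.commute)
    qed simp
    also have "\<dots> = (\<epsilon> * n)\<^sup>2" by (simp add: power2_eq_square)
    finally have "?e \<le> \<epsilon> * n" by (rule power2_le_imp_le) (use \<epsilon> in simp)
    then show ?case unfolding m .
  qed
qed

text \<open>
  If boards of size \<open>q\<close> have small final deficiency at rate \<open>y\<close> for arbitrarily large \<open>q\<close>,
  then playing in blocks of size \<open>q\<close> carries this over to all large boards.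
\<close>

lemma good_rate_if_frequently:
  fixes y \<delta> :: real
  assumes "y > 0" "\<delta> > 0"
    and freq: "\<And>\<epsilon>::real. \<epsilon> > 0 \<Longrightarrow>
      \<exists>\<^sub>F q in sequentially. final_deficiency k q (nat \<lceil>y * q\<rceil>) \<le> \<epsilon> * q"
  shows "good_rate k (y + \<delta>)"
  unfolding good_rate_def
proof (intro allI impI)
  fix \<epsilon> :: real
  assume \<epsilon>: "\<epsilon> > 0"
  \<comment> \<open>The thirds of \<open>\<epsilon>\<close> pay for the final deficiency of the
    blocks, the fluctuation of their hits, and the uncovered vertices once \<open>n\<close> is large
    against \<open>q\<close>.\<close>
  have "\<forall>\<^sub>F q::nat in sequentially. 2 * sqrt (y * q + 3) < \<epsilon> / 3 * q" using \<epsilon> assms(1) by real_asymp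
  \<comment> \<open>The slack \<open>\<delta>\<close> absorbs the rounding of \<open>y * q\<close>,
    so that \<open>r / q \<le> y + \<delta>\<close>.\<close>
  moreover have "\<forall>\<^sub>F q::nat in sequentially. 1 < \<delta> * q" using assms(2) by real_asymp
  moreover have "\<forall>\<^sub>F q::nat in sequentially. 0 < q" by (rule eventually_gt_at_top)
  ultimately have "\<forall>\<^sub>F q::nat in sequentially.
      2 * sqrt (y * q + 3) < \<epsilon> / 3 * q \<and> 1 < \<delta> * q \<and> 0 < q" by eventually_elim auto
  from frequently_eventually_frequently[OF freq[of "\<epsilon> / 3"] this] \<epsilon>
  obtain q where q: "final_deficiency k q (nat \<lceil>y * q\<rceil>) \<le> \<epsilon> / 3 * q"
    "2 * sqrt (y * q + 3) < \<epsilon> / 3 * q" "1 < \<delta> * q" "0 < q"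
    by (auto dest: frequently_ex)
  define r where "r = nat \<lceil>y * q\<rceil>"
  have r: "r \<le> y * q + 1"
    unfolding r_def using assms(1) by (intro of_nat_nat_ceiling_le) simp
  have "\<forall>\<^sub>F n::nat in sequentially. k * q < \<epsilon> / 3 * n" using \<epsilon> by real_asymp
  moreover have "\<forall>\<^sub>F n::nat in sequentially. q \<le> n" by (rule eventually_ge_at_top)
  ultimately show "\<forall>\<^sub>F n in sequentially. final_deficiency k n (nat \<lceil>(y + \<delta>) * n\<rceil>) \<le> \<epsilon> * n"
  proof eventually_elim
    case (elim n)
    have "real r / q \<le> y + \<delta>" using r q by (simp add: field_simps)
    then have "nat \<lceil>r / q * n\<rceil> \<le> nat \<lceil>(y + \<delta>) * n\<rceil>"
      by (intro nat_mono ceiling_mono mult_right_mono) auto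
    then have "final_deficiency k n (nat \<lceil>(y + \<delta>) * n\<rceil>) \<le> final_deficiency k n (nat \<lceil>r / q * n\<rceil>)"
      using q elim by (intro final_deficiency_antimono) auto
    also have "\<dots> \<le> (final_deficiency k q r + 2 * sqrt (real r + 2)) / q * n + k * q"
      using opt_deficiency_scale_le[of q n k r] q elim by simp
    also have "\<dots> \<le> (\<epsilon> / 3 + \<epsilon> / 3) * n + \<epsilon> / 3 * n"
    proof (intro add_mono mult_right_mono)
      have "sqrt (real r + 2) \<le> sqrt (y * q + 3)" using r by simp
      then have "final_deficiency k q r + 2 * sqrt (real r + 2) \<le> \<epsilon> / 3 * q + \<epsilon> / 3 * q"
        using q unfolding r_def by linarith
      then show "(final_deficiency k q r + 2 * sqrt (real r + 2)) / q \<le> \<epsilon> / 3 + \<epsilon> / 3"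
        using q by (simp add: pos_divide_le_eq distrib_right)
    qed (use elim in auto)
    finally show ?case by (simp add: field_simps)
  qed
qed

section \<open>From final deficiencies to \<open>tau\<close>\<close>

lemma tau_le_enat:
  assumes "strategy_on n \<sigma>"
    "p \<le> measure_pmf.prob (semi_random n \<sigma> m) {h. P n (graph_of h)}"
  shows "tau p P n \<le> enat m"
  unfolding tau_def using assms by (intro Inf_lower) auto

lemma enat_le_tau:
  assumes "\<And>m \<sigma>. m < M \<Longrightarrow> strategy_on n \<sigma> \<Longrightarrow>
    measure_pmf.prob (semi_random n \<sigma> m) {h. P n (graph_of h)} < p"
  shows "enat M \<le> tau p P n"
  unfolding tau_def
proof (rule Inf_greatest)
  fix x
  assume "x \<in> {enat m |m. \<exists>\<sigma>. strategy_on n \<sigma> \<and>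
    p \<le> measure_pmf.prob (semi_random n \<sigma> m) {h. P n (graph_of h)}}"
  then obtain m \<sigma> where "x = enat m" "strategy_on n \<sigma>"
    "p \<le> measure_pmf.prob (semi_random n \<sigma> m) {h. P n (graph_of h)}" by auto
  then show "enat M \<le> x" using assms[of m \<sigma>] by (cases "m < M") auto
qed

text \<open>Truncation at 1 keeps the error \<open>C / n\<close> in the range that
  \<open>whp_tau_asymp\<close> prescribes.\<close>

lemma null_sequence_min: "(\<lambda>n::nat. min 1 (C / n)) \<longlonglongrightarrow> (0::real)"
proof -
  have "(\<lambda>n::nat. min 1 (C / n)) \<longlonglongrightarrow> min 1 (0::real)"
    by (intro tendsto_min tendsto_const lim_const_over_n)
  then show ?thesis by simp
qed

lemma le_divide_of_mult_square_le:
  fixes p b e N :: real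
  assumes "p * (e * N)\<^sup>2 \<le> b * N" "e > 0" "N > 0"
  shows "p \<le> b / e\<^sup>2 / N"
proof -
  have "(p * N * e\<^sup>2) * N \<le> b * N"
    using assms(1) by (simp add: power_mult_distrib power2_eq_square ac_simps)
  then have "p * N * e\<^sup>2 \<le> b" using assms(3) by (rule mult_right_le_imp_le)
  then show ?thesis using assms by (simp add: pos_le_divide_eq ac_simps)
qed

text \<open>About \<open>x * n\<close> optimal rounds leave an expected deficiency of at most
  \<open>\<delta> / 8 * n\<close>; then \<open>\<delta> / 2 * n\<close> repair rounds have twice
  that as mean gain. The other half of \<open>\<delta> * n\<close> covers the two roundings.\<close>

lemma tau_upper:
  fixes x \<delta> :: real
  assumes x: "0 \<le> x" "good_rate k x" and \<delta>: "\<delta> > 0"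
  shows "\<exists>C\<ge>0. \<forall>\<^sub>F n in sequentially.
    ereal_of_enat (tau (1 - min 1 (C / n)) (min_neighbours k) n) \<le> ereal ((x + \<delta>) * n)"
proof -
  define C where "C = 4 * (x + \<delta>) / (\<delta> / 8)\<^sup>2"
  have C: "C \<ge> 0" using x \<delta> by (simp add: C_def)
  have "\<forall>\<^sub>F n in sequentially. final_deficiency k n (nat \<lceil>x * n\<rceil>) \<le> \<delta> / 8 * n"
    using x(2)[unfolded good_rate_def, rule_format, of "\<delta> / 8"] \<delta> by simp
  moreover have "\<forall>\<^sub>F n::nat in sequentially. 2 < \<delta> / 2 * n" using \<delta> by real_asymp
  moreover have "\<forall>\<^sub>F n::nat in sequentially. max 1 (2 * k) \<le> n" by (rule eventually_ge_at_top)
  ultimately have "\<forall>\<^sub>F n in sequentially.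
    ereal_of_enat (tau (1 - min 1 (C / n)) (min_neighbours k) n) \<le> ereal ((x + \<delta>) * n)"
  proof eventually_elim
    case (elim n)
    have n: "n > 0" "2 * k \<le> n" using elim by auto
    define m\<^sub>1 where "m\<^sub>1 = nat \<lceil>x * n\<rceil>"
    define m\<^sub>2 where "m\<^sub>2 = nat \<lceil>\<delta> / 2 * n\<rceil>"
    define a where "a = final_deficiency k n m\<^sub>1"
    have m1: "m\<^sub>1 \<le> x * n + 1"
      unfolding m\<^sub>1_def using x by (intro of_nat_nat_ceiling_le) simp
    have m2: "\<delta> / 2 * n \<le> m\<^sub>2" "m\<^sub>2 \<le> \<delta> / 2 * n + 1"
      unfolding m\<^sub>2_def by (rule of_nat_ceiling, rule of_nat_nat_ceiling_le) (use \<delta> in simp)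
    have m: "real (m\<^sub>1 + m\<^sub>2) \<le> (x + \<delta>) * n"
      using m1 m2 elim by (simp add: distrib_right)
    have gap: "\<delta> / 8 * n \<le> m\<^sub>2 / 2 - a" using m2 elim by (simp add: a_def m\<^sub>1_def)
    moreover have "0 \<le> \<delta> / 8 * n" using \<delta> by simp
    ultimately have "a \<le> m\<^sub>2 / 2" by linarith
    from prob_failure_le[OF n a_def this] obtain \<sigma> where \<sigma>: "strategy_on n \<sigma>"
      "measure_pmf.prob (semi_random n \<sigma> (m\<^sub>1 + m\<^sub>2)) {h. \<not> min_neighbours k n (graph_of h)} *
        (m\<^sub>2 / 2 - a)\<^sup>2 \<le> 4 * real (m\<^sub>1 + m\<^sub>2)" by blast
    let ?P = "measure_pmf.prob (semi_random n \<sigma> (m\<^sub>1 + m\<^sub>2))"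
    let ?A = "{h. min_neighbours k n (graph_of h)}"
    have "?P (- ?A) * (\<delta> / 8 * n)\<^sup>2 \<le> ?P (- ?A) * (m\<^sub>2 / 2 - a)\<^sup>2"
      using gap \<delta> by (intro mult_left_mono power_mono) auto
    also have "\<dots> \<le> 4 * real (m\<^sub>1 + m\<^sub>2)" using \<sigma>(2) by (simp only: Collect_neg_eq)
    also have "\<dots> \<le> 4 * (x + \<delta>) * n" using m
      by (simp only: mult.assoc mult_le_cancel_left_pos zero_less_numeral)
    finally have "?P (- ?A) \<le> C / n"
      unfolding C_def using n \<delta> by (intro le_divide_of_mult_square_le) auto
    then have "1 - min 1 (C / n) \<le> ?P ?A"
      using measure_pmf.prob_compl[of ?A "semi_random n \<sigma> (m\<^sub>1 + m\<^sub>2)"]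
      by (auto simp: Compl_eq_Diff_UNIV min_def)
    then have "tau (1 - min 1 (C / n)) (min_neighbours k) n \<le> enat (m\<^sub>1 + m\<^sub>2)"
      by (intro tau_le_enat[OF \<sigma>(1)])
    then have "ereal_of_enat (tau (1 - min 1 (C / n)) (min_neighbours k) n) \<le>
        ereal_of_enat (enat (m\<^sub>1 + m\<^sub>2))" by (simp only: ereal_of_enat_le_iff)
    also have "\<dots> \<le> ereal ((x + \<delta>) * n)" using m by simp
    finally show ?case .
  qed
  then show ?thesis using C by blast
qed

text \<open>The optimal final deficiency only falls with more rounds, so its linear size at rate
  \<open>y\<close> bounds the success probability at all earlier times by
  \<open>O(1 / n)\<close>.\<close>

lemma tau_lower:
  fixes y \<epsilon> :: real
  assumes y: "y > 0" and \<epsilon>: "\<epsilon> > 0"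
    and ev: "\<forall>\<^sub>F n in sequentially. \<epsilon> * n < final_deficiency k n (nat \<lceil>y * n\<rceil>)"
  shows "\<exists>C\<ge>0. \<forall>\<^sub>F n in sequentially.
    ereal (y * n) \<le> ereal_of_enat (tau (min 1 (C / n)) (min_neighbours k) n)"
proof -
  \<comment> \<open>The first term comes from \<open>prob_success_le\<close>. The added 1 makes the
    bound strict, because \<open>tau\<close> accepts a success probability equal to
    \<open>p\<close>.\<close>
  define C where "C = 4 * y / \<epsilon>\<^sup>2 + 1"
  have C: "C \<ge> 0" using y by (simp add: C_def)
  have "\<forall>\<^sub>F n::nat in sequentially. C < n" by real_asymp
  moreover have "\<forall>\<^sub>F n::nat in sequentially. 0 < n" by (rule eventually_gt_at_top)
  ultimately have "\<forall>\<^sub>F n in sequentially.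
    ereal (y * n) \<le> ereal_of_enat (tau (min 1 (C / n)) (min_neighbours k) n)"
    using ev
  proof eventually_elim
    case (elim n)
    let ?M = "nat \<lceil>y * n\<rceil>"
    have "measure_pmf.prob (semi_random n \<sigma> m) {h. min_neighbours k n (graph_of h)} < min 1 (C / n)"
      if m: "m < ?M" and \<sigma>: "strategy_on n \<sigma>" for m \<sigma>
    proof -
      let ?P = "measure_pmf.prob (semi_random n \<sigma> m) {h. min_neighbours k n (graph_of h)}"
      have my: "m < y * n" using m by linarith
      have "?P * (\<epsilon> * n)\<^sup>2 \<le> ?P * (final_deficiency k n m)\<^sup>2"
        using final_deficiency_antimono[of n m ?M k] elim m \<epsilon>
        by (intro mult_left_mono power_mono) auto
      also have "\<dots> \<le> 4 * real m" by (rule prob_success_le[OF \<sigma> elim(2)])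
      also have "\<dots> \<le> 4 * y * n" using my by simp
      finally have "?P \<le> 4 * y / \<epsilon>\<^sup>2 / n"
        using elim \<epsilon> by (intro le_divide_of_mult_square_le) auto
      also have "\<dots> < C / n" unfolding C_def using elim by (intro divide_strict_right_mono) auto
      finally have "?P < C / n" .
      moreover have "C / n < 1" using elim by simp
      ultimately show ?thesis by (simp only: min_def) auto
    qed
    then have "enat ?M \<le> tau (min 1 (C / n)) (min_neighbours k) n" by (rule enat_le_tau)
    then have "ereal_of_enat (enat ?M) \<le> ereal_of_enat (tau (min 1 (C / n)) (min_neighbours k) n)"
      by (simp only: ereal_of_enat_le_iff)
    moreover have "ereal (y * n) \<le> ereal_of_enat (enat ?M)" by simp linarith
    ultimately show ?case by (rule order_trans[rotated])
  qed
  then show ?thesis using C by blast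
qed

theorem theorem1p13:
  fixes k :: nat
  assumes "k \<ge> 1"
  shows "\<exists>h::real. h > 0 \<and> whp_tau_asymp (min_neighbours k) h"
proof -
  define X where "X = {x. 0 \<le> x \<and> good_rate k x}"
  define h where "h = Inf X"
  have X: "X \<noteq> {}" using good_rate_exists[OF assms] by (auto simp: X_def intro!: exI[of _ "4 * real k"])
  have lower: "k / 2 \<le> x" if "x \<in> X" for x using that good_rate_ge by (auto simp: X_def)
  then have bdd: "bdd_below X" by (rule bdd_belowI)
  have "k / 2 \<le> h" unfolding h_def using X lower by (rule cInf_greatest)
  then have h: "h > 0" using assms by simp
  have upper: "\<exists>\<epsilon>::nat \<Rightarrow> real. (\<forall>n. 0 \<le> \<epsilon> n \<and> \<epsilon> n \<le> 1) \<and> \<epsilon> \<longlonglongrightarrow> 0 \<and>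
      (\<forall>\<^sub>F n in sequentially.
         ereal_of_enat (tau (1 - \<epsilon> n) (min_neighbours k) n) \<le> ereal ((h + \<delta>) * real n))"
    if \<delta>: "\<delta> > 0" for \<delta>
  proof -
    obtain x where x: "x \<in> X" "x < h + \<delta>"
      using cInf_lessD[OF X, of "h + \<delta>"] \<delta> by (auto simp: h_def)
    then obtain C where C: "C \<ge> 0" "\<forall>\<^sub>F n in sequentially.
        ereal_of_enat (tau (1 - min 1 (C / n)) (min_neighbours k) n) \<le>
        ereal ((x + (h + \<delta> - x)) * n)"
      using tau_upper[of x k "h + \<delta> - x"] by (auto simp: X_def)
    then show ?thesis
      by (intro exI[of _ "\<lambda>n. min 1 (C / real n)"]) (simp add: null_sequence_min)
  qed
  have lower: "\<exists>\<epsilon>::nat \<Rightarrow> real. (\<forall>n. 0 \<le> \<epsilon> n \<and> \<epsilon> n \<le> 1) \<and> \<epsilon> \<longlonglongrightarrow> 0 \<and>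
      (\<forall>\<^sub>F n in sequentially.
         ereal_of_enat (tau (\<epsilon> n) (min_neighbours k) n) \<ge> ereal ((h - \<delta>) * real n))"
    if \<delta>: "\<delta> > 0" for \<delta>
  proof (cases "h - \<delta> > 0")
    case True
    \<comment> \<open>The rate \<open>h - \<delta> / 2\<close> lies below the infimum. It would be
      good if, for every \<open>\<epsilon>\<close>, the deficiency at rate
      \<open>h - \<delta>\<close> were at most \<open>\<epsilon> * q\<close> for infinitely many
      \<open>q\<close>; hence at rate \<open>h - \<delta>\<close> it is eventually at least
      linear.\<close>
    have "\<not> good_rate k (h - \<delta> + \<delta> / 2)"
    proof
      assume "good_rate k (h - \<delta> + \<delta> / 2)"
      then have "h \<le> h - \<delta> + \<delta> / 2"
        unfolding h_def using True \<delta> by (intro cInf_lower bdd) (simp add: X_def h_def)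
      then show False using \<delta> by simp
    qed
    then obtain \<epsilon> :: real where \<epsilon>: "\<epsilon> > 0"
      "\<not> (\<exists>\<^sub>F q in sequentially. final_deficiency k q (nat \<lceil>(h - \<delta>) * q\<rceil>) \<le> \<epsilon> * q)"
      using good_rate_if_frequently[OF True, of "\<delta> / 2" k] \<delta> by auto
    then obtain C where C: "C \<ge> 0" "\<forall>\<^sub>F n in sequentially.
        ereal ((h - \<delta>) * n) \<le> ereal_of_enat (tau (min 1 (C / n)) (min_neighbours k) n)"
      using tau_lower[OF True, of \<epsilon> k] by (auto simp: not_frequently not_le)
    then show ?thesis
      by (intro exI[of _ "\<lambda>n. min 1 (C / real n)"]) (simp add: null_sequence_min)
  next
    case False
    \<comment> \<open>A nonpositive rate bounds every value of \<open>tau\<close> from below, so the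
      zero sequence suffices.\<close>
    have "ereal ((h - \<delta>) * n) \<le> ereal_of_enat t" for n :: nat and t
    proof -
      have "ereal ((h - \<delta>) * n) \<le> 0" using False by (simp add: mult_nonpos_nonneg)
      also have "0 \<le> ereal_of_enat t" by simp
      finally show ?thesis .
    qed
    then show ?thesis by (intro exI[of _ "\<lambda>_. 0"]) simp
  qed
  show ?thesis unfolding whp_tau_asymp_def using h upper lower by blast
qed

end
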